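(* Let $p$ be a prime with $p\equiv 1\pmod 4$ and let $G=(\mathbb Z_p,+)$. Suppose that the subgroup $\langle 2\rangle$ of the multiplicative group $(\mathbb Z_p\setminus\{0\},\cdot)$ has index $2$. Then $\langle 2\rangle$, regarded as a subset of $G$, is a quasi-signature set in $G$ for a $(p+1,k)$-equiangular frame (for some $k$) if and only if $p\equiv 1\pmod 8$. In this case $k=\frac{p+1}{2}$.
   Context: An $(n,k)$-frame is a Parseval frame $\{f_1,\dots,f_n\}$ for $\mathbb C^k$, i.e. $\sum_{j}|\langle x,f_j\rangle|^2=\|x\|^2$ for all $x\in\mathbb C^k$. It is equiangular if all $f_i\neq 0$ and there is a constant $b$ with $|\langle f_i/\|f_i\|,f_j/\|f_j\|\rangle|=b$ for all $i\ne j$. For $1\le k<n$, put $c_{n,k}=\sqrt{\frac{k(n-k)}{n^2(n-1)}}$. A self-adjoint $n\times n$ matrix $Q$ with $Q_{ii}=0$ and $|Q_{ij}|=1$ for $i\neq j$ is the signature matrix of an $(n,k)$-equiangular frame if there is an equiangular $(n,k)$-frame whose Gram matrix $(\langle f_j,f_i\rangle)_{i,j}$ equals $\frac kn I_n+c_{n,k}Q$. Throughout $1\le k<n$. Let $G$ be a finite group of order $m$ with identity $e$ and left regular representation $\lambda$ (here for $G=(\mathbb Z_p,+)$: $m=p$, $e=0$, $\lambda(g)e_h=e_{g+h}$), regarded as $m\times m$ permutation matrices. For $S\subseteq G\setminus\{e\}$ and $T=(G\setminus\{e\})\setminus S$, let $Q=\sum_{g\in S}\lambda(g)-\sum_{h\in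 T}\lambda(h)$ and let $\tilde Q=\begin{bmatrix}0&C^t\\ C&Q\end{bmatrix}$, where $C\in\mathbb C^m$ is the all-ones column vector. With $n=m+1$, $S$ is a quasi-signature set in $G$ for an $(n,k)$-equiangular frame if the $n\times n$ matrix $\tilde Q$ is the signature matrix of an $(n,k)$-equiangular frame. *)

theory Defs
  imports
    "HOL-Number_Theory.Residues"
    "Jordan_Normal_Form.Schur_Decomposition"
begin

text \<open>
  Vectors of \<open>\<complex>\<^sup>k\<close> are the elements of \<open>carrier_vec k :: complex vec set\<close>, with inner product
  \<open>x \<bullet>c y\<close> (linear in the first argument). Families and matrices of size \<open>n\<close> are indexed by
  \<open>0, \<dots>, n - 1\<close>.
\<close>

definition cvec_norm :: "complex vec \<Rightarrow> real" where
  "cvec_norm x = sqrt (Re (x \<bullet>c x))"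

definition parseval_frame :: "nat \<Rightarrow> nat \<Rightarrow> (nat \<Rightarrow> complex vec) \<Rightarrow> bool" where
  "parseval_frame n k f \<longleftrightarrow>
     (\<forall>j<n. f j \<in> carrier_vec k) \<and>
     (\<forall>x\<in>carrier_vec k. (\<Sum>j<n. (cmod (x \<bullet>c f j))\<^sup>2) = (cvec_norm x)\<^sup>2)"

definition cvec_normalize :: "complex vec \<Rightarrow> complex vec" where
  "cvec_normalize x = complex_of_real (1 / cvec_norm x) \<cdot>\<^sub>v x"

definition equiangular_frame :: "nat \<Rightarrow> nat \<Rightarrow> (nat \<Rightarrow> complex vec) \<Rightarrow> bool" where
  "equiangular_frame n k f \<longleftrightarrow>
     parseval_frame n k f \<and>
     (\<forall>i<n. f i \<noteq> 0\<^sub>v k) \<and>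
     (\<exists>b. \<forall>i<n. \<forall>j<n. i \<noteq> j \<longrightarrow> cmod (cvec_normalize (f i) \<bullet>c cvec_normalize (f j)) = b)"

definition gram_mat :: "nat \<Rightarrow> (nat \<Rightarrow> complex vec) \<Rightarrow> complex mat" where
  "gram_mat n f = mat n n (\<lambda>(i, j). f j \<bullet>c f i)"

definition frame_const :: "nat \<Rightarrow> nat \<Rightarrow> real" where
  "frame_const n k = sqrt (real k * (real n - real k) / ((real n)\<^sup>2 * (real n - 1)))"

definition is_signature_matrix :: "nat \<Rightarrow> nat \<Rightarrow> complex mat \<Rightarrow> bool" where
  "is_signature_matrix n k Q \<longleftrightarrow>
     1 \<le> k \<and> k < n \<and>
     Q \<in> carrier_mat n n \<and> mat_adjoint Q = Q \<and>
     (\<forall>i<n. Q $$ (i, i) = 0) \<and>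
     (\<forall>i<n. \<forall>j<n. i \<noteq> j \<longrightarrow> cmod (Q $$ (i, j)) = 1) \<and>
     (\<exists>f. equiangular_frame n k f \<and>
          gram_mat n f = complex_of_real (real k / real n) \<cdot>\<^sub>m 1\<^sub>m n
                         + complex_of_real (frame_const n k) \<cdot>\<^sub>m Q)"

text \<open>
  An enumeration \<open>u\<close> of the group, i.e. a bijection from \<open>{..<order G}\<close> onto \<open>carrier G\<close>, orders
  the standard basis \<open>(e\<^sub>h)\<close> and so turns the left regular representation, \<open>\<lambda>(g) e\<^sub>h = e\<^sub>g\<^sub>h\<close>, into
  a representation by permutation matrices.
\<close>

definition left_regular_mat ::
    "('a, 'b) monoid_scheme \<Rightarrow> (nat \<Rightarrow> 'a) \<Rightarrow> 'a \<Rightarrow> complex mat" where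
  "left_regular_mat G u g =
     mat (Coset.order G) (Coset.order G) (\<lambda>(i, j). if u i = g \<otimes>\<^bsub>G\<^esub> u j then 1 else 0)"

definition mat_sum :: "nat \<Rightarrow> ('a \<Rightarrow> complex mat) \<Rightarrow> 'a set \<Rightarrow> complex mat" where
  "mat_sum m A S = mat m m (\<lambda>(i, j). \<Sum>g\<in>S. A g $$ (i, j))"

definition signed_regular_mat ::
    "('a, 'b) monoid_scheme \<Rightarrow> (nat \<Rightarrow> 'a) \<Rightarrow> 'a set \<Rightarrow> complex mat" where
  "signed_regular_mat G u S =
     mat_sum (Coset.order G) (left_regular_mat G u) S
     - mat_sum (Coset.order G) (left_regular_mat G u) ((carrier G - {\<one>\<^bsub>G\<^esub>}) - S)"

definition bordered_mat :: "nat \<Rightarrow> complex mat \<Rightarrow> complex mat" where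
  "bordered_mat m Q =
     (let C = mat m 1 (\<lambda>_. 1) in four_block_mat (0\<^sub>m 1 1) (transpose_mat C) C Q)"

text \<open>
  The choice of the enumeration is immaterial: another one conjugates the bordered matrix by a
  permutation matrix, which amounts to a reindexing of the frame.
\<close>

definition quasi_signature_set ::
    "('a, 'b) monoid_scheme \<Rightarrow> 'a set \<Rightarrow> nat \<Rightarrow> nat \<Rightarrow> bool" where
  "quasi_signature_set G S n k \<longleftrightarrow>
     group G \<and> finite (carrier G) \<and> S \<subseteq> carrier G - {\<one>\<^bsub>G\<^esub>} \<and> n = Coset.order G + 1 \<and>
     (\<exists>u. bij_betw u {..<Coset.order G} (carrier G) \<and>
          is_signature_matrix n k (bordered_mat (Coset.order G) (signed_regular_mat G u S)))"

(* the residues 0, ..., p - 1 as integers, so that subsets of Z_mult p are subsets of Z_add p *)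
definition Z_add :: "nat \<Rightarrow> int monoid" where
  "Z_add p = add_monoid (residue_ring (int p))"

definition Z_mult :: "nat \<Rightarrow> int monoid" where
  "Z_mult p = mult_of (residue_ring (int p))"

end

theory Submission
  imports Defs "HOL-Number_Theory.Euler_Criterion"
begin

text \<open>
  A subgroup of index two of the cyclic group of non-zero residues is the group of quadratic residues
  (\<open>index_2_subgroup_eq_quadratic_residues\<close>). So the matrix attached to \<open>\<langle>2\<rangle>\<close> has the entries \<open>\<chi>(g - h)\<close>,
  where \<open>\<chi>\<close> is the Legendre symbol: it is Paley's matrix. For \<open>p = 1\<close> modulo \<open>4\<close> it is symmetric, and
  the evaluation \<open>-1\<close> of the sums of \<open>\<chi>(x) \<chi>(x + a)\<close> over \<open>x\<close> (\<open>sum_Legendre_correlation\<close>) shows that the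
  bordered matrix \<open>Q\<close> satisfies \<open>Q\<^sup>2 = p I\<close>.

  Put \<open>n = p + 1\<close>. A matrix is the Gram matrix of a Parseval frame for \<open>\<complex>\<^sup>k\<close> exactly if it is an
  orthogonal projection of rank \<open>k\<close>. Since \<open>Q\<^sup>2 = (n - 1) I\<close>, the matrix \<open>(k / n) I + c Q\<close> is one if and
  only if \<open>k = n / 2\<close> (\<open>is_signature_conference_matrix_iff\<close>). Hence \<open>\<langle>2\<rangle>\<close> always is a quasi-signature
  set, for \<open>k = (p + 1) / 2\<close> and no other \<open>k\<close>.

  The right-hand side of the equivalence always holds as well: \<open>2\<close> is an element of \<open>\<langle>2\<rangle>\<close> and therefore
  a square, and an odd prime with \<open>p = 1\<close> modulo \<open>4\<close> for which \<open>2\<close> is a square satisfies \<open>p = 1\<close>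
  modulo \<open>8\<close> (\<open>cong_1_mod_8_if_two_is_square\<close>).
\<close>

section \<open>Gram matrices of Parseval frames\<close>

text \<open>
  An orthogonal projection of trace \<open>k\<close> is \<open>W W\<^sup>*\<close> for a matrix \<open>W\<close> with \<open>k\<close> orthonormal columns.
  The columns are split off one at a time: each column of \<open>P\<close> is fixed by \<open>P\<close>, so a normalized
  non-zero column \<open>v\<close> gives a projection \<open>P - v v\<^sup>*\<close> whose trace is smaller by one. Such a column
  exists while the trace is non-zero, and \<open>P = 0\<close> when it vanishes, because the trace of \<open>P = P P\<^sup>*\<close>
  is the sum of the squared moduli of all entries.
\<close>

lemma hermitian_idempotent_eq_sum_outer_products:
  fixes P :: "nat \<Rightarrow> nat \<Rightarrow> complex"
  assumes "\<And>i j. i < n \<Longrightarrow> j < n \<Longrightarrow> P j i = cnj (P i j)"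
    and "\<And>i j. i < n \<Longrightarrow> j < n \<Longrightarrow> (\<Sum>l<n. P i l * P l j) = P i j"
    and "(\<Sum>i<n. P i i) = of_nat k"
  shows "\<exists>w :: nat \<Rightarrow> nat \<Rightarrow> complex.
    (\<forall>a<k. \<forall>b<k. (\<Sum>i<n. w a i * cnj (w b i)) = (if a = b then 1 else 0)) \<and>
    (\<forall>i<n. \<forall>j<n. P i j = (\<Sum>a<k. w a i * cnj (w a j)))"
  using assms
proof (induction k arbitrary: P)
  case (0 P)
  have diag: "P i i = of_real (\<Sum>l<n. (cmod (P i l))\<^sup>2)" if "i < n" for i
    unfolding of_real_sum
    by (subst "0.prems"(2)[OF that that, symmetric], rule sum.cong)
      (auto simp: "0.prems"(1)[OF that] simp flip: complex_norm_square)
  have "of_real (\<Sum>i<n. \<Sum>l<n. (cmod (P i l))\<^sup>2) = (0::complex)"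
    using "0.prems"(3) by (simp add: diag)
  then have "(\<Sum>i<n. \<Sum>l<n. (cmod (P i l))\<^sup>2) = 0"
    by (simp only: of_real_eq_0_iff)
  then have "\<forall>i<n. \<forall>l<n. P i l = 0"
    by (simp add: sum_nonneg_eq_0_iff sum_nonneg)
  then show ?case by simp
next
  case (Suc k P)
  note herm = Suc.prems(1) and idem = Suc.prems(2)
  have "\<exists>c<n. P c c \<noteq> 0"
  proof (rule ccontr)
    assume "\<not> (\<exists>c<n. P c c \<noteq> 0)"
    then have "(\<Sum>i<n. P i i) = 0" by simp
    then show False using Suc.prems(3) by (simp del: of_nat_Suc)
  qed
  then obtain c where c: "c < n" "P c c \<noteq> 0" by blast
  define d where "d = (\<Sum>l<n. (cmod (P c l))\<^sup>2)"
  have d: "P c c = of_real d"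
    unfolding d_def of_real_sum
    by (subst idem[OF c(1) c(1), symmetric], rule sum.cong)
      (auto simp: herm[OF c(1)] simp flip: complex_norm_square)
  have "d \<ge> 0" unfolding d_def by (simp add: sum_nonneg)
  with c d have "d > 0" by (simp add: order_less_le)
  define r :: complex where "r = of_real (sqrt d)"
  have r: "r \<noteq> 0" "r * r = P c c" "cnj r = r"
    using \<open>d > 0\<close> by (auto simp: r_def d simp flip: of_real_mult)
  define v where "v i = P i c / r" for i
  have cnj_v: "cnj (v i) = P c i / r" if "i < n" for i
    using herm[OF that c(1)] by (simp add: v_def r)
  have norm_v: "(\<Sum>i<n. v i * cnj (v i)) = 1"
  proof -
    have "(\<Sum>i<n. v i * cnj (v i)) = (\<Sum>i<n. P c i * P i c) / (r * r)"
      unfolding sum_divide_distrib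
      by (rule sum.cong) (auto simp: cnj_v, simp add: v_def mult.commute)
    then show ?thesis using idem[OF c(1) c(1)] r c by simp
  qed
  have Pv: "(\<Sum>l<n. P i l * v l) = v i" if "i < n" for i
    using idem[OF that c(1)] by (simp add: v_def flip: sum_divide_distrib)
  have vP: "(\<Sum>l<n. cnj (v l) * P l j) = cnj (v j)" if "j < n" for j
  proof -
    have "(\<Sum>l<n. cnj (v l) * P l j) = (\<Sum>l<n. P c l * P l j) / r"
      unfolding sum_divide_distrib by (rule sum.cong) (auto simp: cnj_v)
    then show ?thesis using idem[OF c(1) that] that by (simp add: cnj_v)
  qed
  define P' where "P' i j = P i j - v i * cnj (v j)" for i j
  have P'v: "(\<Sum>l<n. P' i l * v l) = 0" if "i < n" for i
  proof -
    have "(\<Sum>l<n. P' i l * v l) = (\<Sum>l<n. P i l * v l) - v i * (\<Sum>l<n. v l * cnj (v l))"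
      by (simp add: P'_def algebra_simps sum_subtractf sum_distrib_left)
    then show ?thesis using Pv[OF that] norm_v by simp
  qed
  have "\<exists>w. (\<forall>a<k. \<forall>b<k. (\<Sum>i<n. w a i * cnj (w b i)) = (if a = b then 1 else 0)) \<and>
            (\<forall>i<n. \<forall>j<n. P' i j = (\<Sum>a<k. w a i * cnj (w a j)))"
  proof (rule Suc.IH)
    fix i j assume ij: "i < n" "j < n"
    show "P' j i = cnj (P' i j)" using herm[OF ij] by (simp add: P'_def)
    have "(\<Sum>l<n. P' i l * P' l j) = (\<Sum>l<n. P' i l * P l j) - (\<Sum>l<n. P' i l * v l) * cnj (v j)"
      by (simp add: P'_def[of _ j] algebra_simps sum_subtractf sum_distrib_left)
    also have "\<dots> = (\<Sum>l<n. P i l * P l j) - v i * (\<Sum>l<n. cnj (v l) * P l j)"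
      using P'v[OF ij(1)] by (simp add: P'_def algebra_simps sum_subtractf sum_distrib_left)
    also have "\<dots> = P' i j" using idem[OF ij] vP[OF ij(2)] by (simp add: P'_def)
    finally show "(\<Sum>l<n. P' i l * P' l j) = P' i j" .
  next
    show "(\<Sum>i<n. P' i i) = of_nat k"
      using Suc.prems(3) norm_v by (simp add: P'_def sum_subtractf)
  qed
  then obtain w where w_orth: "\<And>a b. a < k \<Longrightarrow> b < k \<Longrightarrow>
      (\<Sum>i<n. w a i * cnj (w b i)) = (if a = b then 1 else 0)"
    and w_P': "\<And>i j. i < n \<Longrightarrow> j < n \<Longrightarrow> P' i j = (\<Sum>a<k. w a i * cnj (w a j))"
    by blast
  \<comment> \<open>The new vector is orthogonal to the old ones: \<open>0 = v\<^sup>* P' v\<close> is the sum of the squared moduli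
      of the inner products \<open>s a\<close>.\<close>
  define s where "s a = (\<Sum>i<n. w a i * cnj (v i))" for a
  have "(\<Sum>a<k. s a * cnj (s a)) = (\<Sum>i<n. cnj (v i) * (\<Sum>j<n. P' i j * v j))"
  proof -
    have "(\<Sum>a<k. s a * cnj (s a))
        = (\<Sum>a<k. \<Sum>i<n. \<Sum>j<n. w a i * cnj (v i) * (cnj (w a j) * v j))"
      by (simp add: s_def sum_product)
    also have "\<dots> = (\<Sum>i<n. \<Sum>j<n. \<Sum>a<k. w a i * cnj (v i) * (cnj (w a j) * v j))"
      by (subst sum.swap, rule sum.cong[OF refl], rule sum.swap)
    also have "\<dots> = (\<Sum>i<n. cnj (v i) * (\<Sum>j<n. P' i j * v j))"
      by (simp add: w_P' sum_distrib_left sum_distrib_right mult_ac)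
    finally show ?thesis .
  qed
  also have "\<dots> = 0" by (simp add: P'v)
  finally have "of_real (\<Sum>a<k. (cmod (s a))\<^sup>2) = (0::complex)"
    unfolding of_real_sum complex_norm_square .
  then have "(\<Sum>a<k. (cmod (s a))\<^sup>2) = 0" by (simp only: of_real_eq_0_iff)
  then have s0: "s a = 0" if "a < k" for a
    using that by (simp add: sum_nonneg_eq_0_iff)
  have s0': "(\<Sum>i<n. v i * cnj (w a i)) = 0" if "a < k" for a
  proof -
    have "(\<Sum>i<n. v i * cnj (w a i)) = cnj (s a)" by (simp add: s_def mult.commute)
    then show ?thesis using s0[OF that] by simp
  qed
  define w' where "w' a = (if a = k then v else w a)" for a
  have "(\<Sum>i<n. w' a i * cnj (w' b i)) = (if a = b then 1 else 0)"
    if "a < Suc k" "b < Suc k" for a b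
    using that w_orth[of a b] s0[of a] s0'[of b] norm_v by (auto simp: w'_def s_def less_Suc_eq)
  moreover have "P i j = (\<Sum>a<Suc k. w' a i * cnj (w' a j))" if "i < n" "j < n" for i j
    using w_P'[OF that] by (simp add: w'_def P'_def diff_eq_eq)
  ultimately show ?case by blast
qed

lemma complex_inner_vec:
  "x \<bullet>c y = (\<Sum>a<dim_vec y. x $ a * cnj (y $ a))"
  by (simp add: scalar_prod_def atLeast0LessThan conjugate_complex_def)

lemma cvec_norm_power2: "complex_of_real ((cvec_norm x)\<^sup>2) = x \<bullet>c x"
proof -
  have "x \<bullet>c x = of_real (\<Sum>a<dim_vec x. (cmod (x $ a))\<^sup>2)"
    by (simp add: complex_inner_vec complex_norm_square of_real_sum del: of_real_power)
  then show ?thesis by (simp add: cvec_norm_def sum_nonneg)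
qed

text \<open>
  The Parseval identity for norms, polarized. The difference \<open>S\<close> of the two sides is a sesquilinear
  form with \<open>S z z = 0\<close> for all \<open>z\<close>; expanding at \<open>z = x + t y\<close> for \<open>t = 1\<close> and \<open>t = \<i>\<close> gives
  \<open>S x y = 0\<close>.
\<close>

lemma parseval_frame_inner_product:
  assumes "parseval_frame n k f" and x: "x \<in> carrier_vec k" and y: "y \<in> carrier_vec k"
  shows "(\<Sum>l<n. (x \<bullet>c f l) * cnj (y \<bullet>c f l)) = x \<bullet>c y"
proof -
  have f: "f l \<in> carrier_vec k" if "l < n" for l
    using assms that by (simp add: parseval_frame_def)
  have norm: "(\<Sum>l<n. (z \<bullet>c f l) * cnj (z \<bullet>c f l)) = z \<bullet>c z" if "z \<in> carrier_vec k" for z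
  proof -
    have "complex_of_real (\<Sum>l<n. (cmod (z \<bullet>c f l))\<^sup>2) = complex_of_real ((cvec_norm z)\<^sup>2)"
      using assms(1) that by (simp add: parseval_frame_def)
    then show ?thesis
      unfolding cvec_norm_power2 of_real_sum complex_norm_square .
  qed
  define S where "S z z' = (\<Sum>l<n. (z \<bullet>c f l) * cnj (z' \<bullet>c f l)) - z \<bullet>c z'" for z z'
  have lin: "(x + t \<cdot>\<^sub>v y) \<bullet>c z = x \<bullet>c z + t * (y \<bullet>c z)" if "z \<in> carrier_vec k" for t z
    using x y that by (simp add: complex_inner_vec algebra_simps sum.distrib sum_distrib_left)
  have lin': "z \<bullet>c (x + t \<cdot>\<^sub>v y) = z \<bullet>c x + cnj t * (z \<bullet>c y)" if "z \<in> carrier_vec k" for t z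
    using x y that by (simp add: complex_inner_vec algebra_simps sum.distrib sum_distrib_left)
  have S: "cnj t * S x y + t * S y x = 0" for t
  proof -
    let ?z = "x + t \<cdot>\<^sub>v y"
    have z: "?z \<in> carrier_vec k" using x y by simp
    have "(\<Sum>l<n. (?z \<bullet>c f l) * cnj (?z \<bullet>c f l)) =
        (\<Sum>l<n. (x \<bullet>c f l) * cnj (x \<bullet>c f l)) + cnj t * (\<Sum>l<n. (x \<bullet>c f l) * cnj (y \<bullet>c f l))
        + t * (\<Sum>l<n. (y \<bullet>c f l) * cnj (x \<bullet>c f l))
        + t * cnj t * (\<Sum>l<n. (y \<bullet>c f l) * cnj (y \<bullet>c f l))"
      by (simp add: lin f algebra_simps sum.distrib sum_distrib_left)
    moreover have "?z \<bullet>c ?z = x \<bullet>c x + cnj t * (x \<bullet>c y) + t * (y \<bullet>c x) + t * cnj t * (y \<bullet>c y)"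
      using x y z by (simp add: lin lin' algebra_simps)
    ultimately show ?thesis
      using norm[OF x] norm[OF y] norm[OF z] by (simp add: S_def algebra_simps)
  qed
  from S[of 1] S[of \<i>] have "S x y = 0" by (simp add: algebra_simps add_eq_0_iff2)
  then show ?thesis by (simp add: S_def)
qed

lemma gram_mat_index:
  "i < n \<Longrightarrow> j < n \<Longrightarrow> gram_mat n f $$ (i, j) = f j \<bullet>c f i"
  by (simp add: gram_mat_def)

text \<open>
  Each entry of this identity is the polarized Parseval identity for two frame vectors.
\<close>

lemma parseval_frame_gram_idempotent:
  assumes "parseval_frame n k f" and "i < n" "j < n"
  shows "(\<Sum>l<n. gram_mat n f $$ (i, l) * gram_mat n f $$ (l, j)) = gram_mat n f $$ (i, j)"
proof -
  have f: "f l \<in> carrier_vec k" if "l < n" for l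
    using assms that by (simp add: parseval_frame_def)
  have "f l \<bullet>c f i = cnj (f i \<bullet>c f l)" if "l < n" for l
    using f[OF that] f[OF assms(2)] by (simp add: complex_inner_vec mult.commute)
  then have "(\<Sum>l<n. gram_mat n f $$ (i, l) * gram_mat n f $$ (l, j))
      = (\<Sum>l<n. (f j \<bullet>c f l) * cnj (f i \<bullet>c f l))"
    using assms by (intro sum.cong) (auto simp: gram_mat_index)
  then show ?thesis
    using parseval_frame_inner_product[OF assms(1) f[OF assms(3)] f[OF assms(2)]] assms
    by (simp add: gram_mat_index)
qed

text \<open>
  With \<open>P = W W\<^sup>*\<close> as above, the conjugated rows of \<open>W\<close> are frame vectors with Gram matrix \<open>P\<close>;
  orthonormality of the columns of \<open>W\<close> is the Parseval property.
\<close>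

lemma parseval_frame_of_hermitian_idempotent:
  assumes P: "P \<in> carrier_mat n n"
    and herm: "\<And>i j. i < n \<Longrightarrow> j < n \<Longrightarrow> P $$ (j, i) = cnj (P $$ (i, j))"
    and idem: "\<And>i j. i < n \<Longrightarrow> j < n \<Longrightarrow> (\<Sum>l<n. P $$ (i, l) * P $$ (l, j)) = P $$ (i, j)"
    and trace: "(\<Sum>i<n. P $$ (i, i)) = of_nat k"
  obtains f where "parseval_frame n k f" "gram_mat n f = P"
proof -
  obtain w :: "nat \<Rightarrow> nat \<Rightarrow> complex" where
    w: "\<And>a b. a < k \<Longrightarrow> b < k \<Longrightarrow> (\<Sum>i<n. w a i * cnj (w b i)) = (if a = b then 1 else 0)"
    and wP: "\<And>i j. i < n \<Longrightarrow> j < n \<Longrightarrow> P $$ (i, j) = (\<Sum>a<k. w a i * cnj (w a j))"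
    using hermitian_idempotent_eq_sum_outer_products[of n "\<lambda>i j. P $$ (i, j)" k, OF herm idem trace]
    by blast
  \<comment> \<open>The conjugation compensates that the inner product is linear in its first argument.\<close>
  define f where "f j = vec k (\<lambda>a. cnj (w a j))" for j
  have f: "x \<bullet>c f j = (\<Sum>a<k. x $ a * w a j)" for x j
    by (simp add: complex_inner_vec f_def)
  have "(\<Sum>j<n. (cmod (x \<bullet>c f j))\<^sup>2) = (cvec_norm x)\<^sup>2" if x: "x \<in> carrier_vec k" for x
  proof -
    have "complex_of_real (\<Sum>j<n. (cmod (x \<bullet>c f j))\<^sup>2)
        = (\<Sum>j<n. \<Sum>a<k. \<Sum>b<k. x $ a * w a j * (cnj (x $ b) * cnj (w b j)))"
      unfolding of_real_sum complex_norm_square by (simp add: f sum_product)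
    also have "\<dots> = (\<Sum>a<k. \<Sum>b<k. \<Sum>j<n. x $ a * w a j * (cnj (x $ b) * cnj (w b j)))"
      by (subst sum.swap, rule sum.cong[OF refl], rule sum.swap)
    also have "\<dots> = (\<Sum>a<k. \<Sum>b<k. x $ a * cnj (x $ b) * (\<Sum>j<n. w a j * cnj (w b j)))"
      by (simp add: sum_distrib_left mult_ac)
    also have "\<dots> = (\<Sum>a<k. \<Sum>b<k. x $ a * cnj (x $ b) * (if a = b then 1 else 0))"
      by (simp add: w)
    also have "\<dots> = complex_of_real ((cvec_norm x)\<^sup>2)"
      using x unfolding cvec_norm_power2 by (simp add: complex_inner_vec if_distrib[of "(*) _"] cong: if_cong)
    finally show ?thesis by (simp only: of_real_eq_iff)
  qed
  then have "parseval_frame n k f" by (simp add: parseval_frame_def f_def)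
  moreover have "gram_mat n f = P"
    by (rule eq_matI) (use P in \<open>auto simp: gram_mat_def f wP\<close>,
        simp add: f_def mult.commute)
  ultimately show thesis by (rule that)
qed

section \<open>Conference matrices as signature matrices\<close>

lemma mat_adjoint_index:
  "i < dim_col A \<Longrightarrow> j < dim_row A \<Longrightarrow> mat_adjoint A $$ (i, j) = cnj (A $$ (j, i))"
  by (simp add: mat_adjoint_def mat_of_rows_def conjugate_complex_def)

lemma mat_adjoint_dim: "dim_row (mat_adjoint A) = dim_col A" "dim_col (mat_adjoint A) = dim_row A"
  by (simp_all add: mat_adjoint_def)

text \<open>
  The hypotheses say that \<open>Q\<close> is a Hermitian conference matrix: \<open>Q\<^sup>2 = (n - 1) I\<close>. For
  \<open>G = a I + c Q\<close> with \<open>a = k / n\<close>, the off-diagonal entries of \<open>G\<^sup>2\<close> are \<open>2 a\<close> times those of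
  \<open>G\<close>. As \<open>c \<noteq> 0\<close>, idempotence of a Gram matrix \<open>G\<close> forces \<open>a = 1 / 2\<close>. Conversely, if
  \<open>a = 1 / 2\<close> then \<open>c\<^sup>2 (n - 1) = 1 / 4\<close>, so that \<open>G\<close> is a projection, and its trace is \<open>k\<close>; the
  frame with this Gram matrix is equiangular because the off-diagonal entries of \<open>G\<close> all have
  modulus \<open>\<bar>c\<bar>\<close>.
\<close>

lemma is_signature_conference_matrix_iff:
  assumes n: "n \<ge> 2" and Q: "Q \<in> carrier_mat n n" and adj: "mat_adjoint Q = Q"
    and diag: "\<And>i. i < n \<Longrightarrow> Q $$ (i, i) = 0"
    and off: "\<And>i j. i < n \<Longrightarrow> j < n \<Longrightarrow> i \<noteq> j \<Longrightarrow> cmod (Q $$ (i, j)) = 1"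
    and sq: "\<And>i j. i < n \<Longrightarrow> j < n \<Longrightarrow>
      (\<Sum>l<n. Q $$ (i, l) * Q $$ (l, j)) = (if i = j then of_nat (n - 1) else 0)"
  shows "is_signature_matrix n k Q \<longleftrightarrow> 2 * k = n"
proof -
  define a where "a = complex_of_real (real k / real n)"
  define c where "c = complex_of_real (frame_const n k)"
  define G where "G = a \<cdot>\<^sub>m 1\<^sub>m n + c \<cdot>\<^sub>m Q"
  have G: "G $$ (i, j) = (if i = j then a else 0) + c * Q $$ (i, j)" if "i < n" "j < n" for i j
    using that Q by (simp add: G_def)
  have G2: "(\<Sum>l<n. G $$ (i, l) * G $$ (l, j)) =
      (if i = j then a * a + c * c * of_nat (n - 1) else 2 * a * c * Q $$ (i, j))"
    if ij: "i < n" "j < n" for i j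
  proof -
    have "(\<Sum>l<n. G $$ (i, l) * G $$ (l, j)) =
       (\<Sum>l<n. (if i = l then a * (if l = j then a else 0) else 0) + (if i = l then a * c * Q $$ (l, j) else 0)
         + (if l = j then a * c * Q $$ (i, l) else 0) + c * c * (Q $$ (i, l) * Q $$ (l, j)))"
      using ij by (intro sum.cong) (auto simp: G algebra_simps)
    also have "\<dots> = (if i = j then a * a else 0) + a * c * Q $$ (i, j) + a * c * Q $$ (i, j)
         + c * c * (\<Sum>l<n. Q $$ (i, l) * Q $$ (l, j))"
      using ij by (simp add: sum.distrib flip: sum_distrib_left)
    finally show ?thesis unfolding sq[OF ij] using ij by (simp add: diag)
  qed
  have c0: "c \<noteq> 0" if "1 \<le> k" "k < n"
  proof -
    have "0 < real k * (real n - real k) / ((real n)\<^sup>2 * (real n - 1))"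
      using that n by (intro divide_pos_pos mult_pos_pos) auto
    then show ?thesis using that n by (simp add: c_def frame_const_def)
  qed
  show ?thesis
  proof
    assume sig: "is_signature_matrix n k Q"
    then obtain f where kn: "1 \<le> k" "k < n" and f: "equiangular_frame n k f" "gram_mat n f = G"
      by (auto simp: is_signature_matrix_def G_def a_def c_def)
    then have "parseval_frame n k f" by (simp add: equiangular_frame_def)
    from parseval_frame_gram_idempotent[OF this, of 0 1]
    have "(\<Sum>l<n. G $$ (0, l) * G $$ (l, 1)) = G $$ (0, 1)" using n f(2) by simp
    then have "2 * a * c * Q $$ (0, 1) = c * Q $$ (0, 1)"
      using n G2[of 0 1] G[of 0 1] by simp
    moreover have "Q $$ (0, 1) \<noteq> 0" using off[of 0 1] n by auto
    ultimately have "2 * a = 1" using c0[OF kn] by simp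
    then have "2 * (real k / real n) = 1"
      unfolding a_def by (metis of_real_eq_iff of_real_mult of_real_numeral of_real_1)
    then have "2 * real k = real n" using n by (simp add: field_simps)
    then show "2 * k = n" by linarith
  next
    assume k: "2 * k = n"
    then have kn: "1 \<le> k" "k < n" using n by auto
    have rn: "real n = 2 * real k" using k by simp
    have a: "a = 1 / 2" using kn by (simp add: a_def rn)
    have "(frame_const n k)\<^sup>2 * (real n - 1) = 1 / 4"
    proof -
      have "real k * (real n - real k) / ((real n)\<^sup>2 * (real n - 1)) = 1 / (4 * (real n - 1))"
        using kn by (simp add: rn field_simps power2_eq_square)
      then have "(frame_const n k)\<^sup>2 = 1 / (4 * (real n - 1))"
        unfolding frame_const_def using n by simp
      then show ?thesis using n by simp
    qed
    then have "complex_of_real ((frame_const n k)\<^sup>2 * (real n - 1)) = complex_of_real (1 / 4)"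
      by (simp only:)
    then have c2: "c * c * of_nat (n - 1) = 1 / 4"
      using n by (simp add: c_def of_nat_diff power2_eq_square)
    have Gherm: "G $$ (j, i) = cnj (G $$ (i, j))" if "i < n" "j < n" for i j
    proof -
      have "Q $$ (j, i) = cnj (Q $$ (i, j))"
        using mat_adjoint_index[of j Q i] adj Q that by auto
      then show ?thesis using that by (simp add: G a_def c_def)
    qed
    obtain f where f: "parseval_frame n k f" "gram_mat n f = G"
    proof (rule parseval_frame_of_hermitian_idempotent)
      show "G \<in> carrier_mat n n" using Q by (simp add: G_def)
      show "(\<Sum>l<n. G $$ (i, l) * G $$ (l, j)) = G $$ (i, j)" if "i < n" "j < n" for i j
        unfolding G2[OF that] G[OF that] c2 a using that by (simp add: diag)
      show "(\<Sum>i<n. G $$ (i, i)) = of_nat k"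
        using k by (simp add: G diag a flip: k)
      show "G $$ (j, i) = cnj (G $$ (i, j))" if "i < n" "j < n" for i j
        using that by (rule Gherm)
    qed (rule that)
    have inner: "f j \<bullet>c f i = G $$ (i, j)" if "i < n" "j < n" for i j
      using that f(2) by (simp flip: gram_mat_index)
    have carr: "f i \<in> carrier_vec k" if "i < n" for i
      using f(1) that by (simp add: parseval_frame_def)
    have nz: "f i \<noteq> 0\<^sub>v k" if "i < n" for i
    proof
      assume "f i = 0\<^sub>v k"
      then show False using inner[OF that that] that a by (simp add: G diag complex_inner_vec)
    qed
    have norm: "cvec_norm (f i) = sqrt (1 / 2)" if "i < n" for i
      unfolding cvec_norm_def by (simp add: inner that G diag a)
    have "cmod (cvec_normalize (f i) \<bullet>c cvec_normalize (f j)) = 2 * cmod c"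
      if ij: "i < n" "j < n" "i \<noteq> j" for i j
    proof -
      have "cvec_normalize (f i) \<bullet>c cvec_normalize (f j) = 
          of_real (1 / cvec_norm (f i)) * of_real (1 / cvec_norm (f j)) * (f i \<bullet>c f j)"
        using carr[OF ij(1)] carr[OF ij(2)]
        by (simp add: cvec_normalize_def complex_inner_vec sum_distrib_left mult_ac)
      also have "\<dots> = 2 * (c * Q $$ (j, i))"
        using ij by (simp add: norm inner G real_sqrt_divide flip: of_real_mult)
      finally show ?thesis using off[of j i] ij by (simp add: norm_mult)
    qed
    then have "equiangular_frame n k f"
      unfolding equiangular_frame_def using f(1) nz by blast
    then show "is_signature_matrix n k Q"
      unfolding is_signature_matrix_def using kn Q adj diag off f(2)
      by (auto simp: G_def a_def c_def)
  qed
qed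

section \<open>The Legendre symbol\<close>

lemma Legendre_cong: "[a = b] (mod p) \<Longrightarrow> Legendre a p = Legendre b p"
  by (auto simp: Legendre_def QuadRes_def cong_def)

lemma Legendre_values: "Legendre a p \<in> {0, 1, -1}"
  by (simp add: Legendre_def)

lemma Legendre_eq_0_iff: "Legendre a p = 0 \<longleftrightarrow> [a = 0] (mod p)"
  by (simp add: Legendre_def)

lemma Legendre_square:
  "\<not> [a = 0] (mod p) \<Longrightarrow> Legendre a p * Legendre a p = 1"
  by (simp add: Legendre_def)

text \<open>
  Modulo an odd prime the three values of a Legendre symbol are incongruent, so that congruences
  between Legendre symbols are equalities.
\<close>

lemma sign_cong_imp_eq:
  fixes s t p :: int
  assumes "[s = t] (mod p)" "p > 2" "s \<in> {0, 1, -1}" "t \<in> {0, 1, -1}"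
  shows "s = t"
proof (rule ccontr)
  assume "s \<noteq> t"
  moreover have "p dvd s - t" using assms(1) by (simp add: cong_iff_dvd_diff)
  ultimately have "\<bar>p\<bar> \<le> \<bar>s - t\<bar>" by (intro dvd_imp_le_int) auto
  then show False using assms by auto
qed

lemma Legendre_eq_iff_pow_cong:
  assumes "prime p" "2 < p" "s \<in> {0, 1, -1}"
  shows "Legendre a (int p) = s \<longleftrightarrow> [a ^ ((p - 1) div 2) = s] (mod int p)"
  using euler_criterion[OF assms(1,2), of a] sign_cong_imp_eq[of "Legendre a p" s "int p"]
    Legendre_values[of a p] assms(2,3) by (auto dest: cong_trans cong_sym)

lemma Legendre_mult:
  assumes p: "prime p" "2 < p"
  shows "Legendre (a * b) (int p) = Legendre a (int p) * Legendre b (int p)"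
proof -
  have "[a ^ ((p - 1) div 2) * b ^ ((p - 1) div 2) = Legendre a (int p) * Legendre b (int p)] (mod int p)"
    using euler_criterion[OF p] by (intro cong_mult) (auto intro: cong_sym)
  moreover have "Legendre a (int p) * Legendre b (int p) \<in> {0, 1, -1}"
    by (simp add: Legendre_def)
  ultimately show ?thesis
    by (simp add: Legendre_eq_iff_pow_cong[OF p] power_mult_distrib)
qed

lemma prime_cong_1_mod_4_gt_2:
  assumes "prime (p :: nat)" "[p = 1] (mod 4)"
  shows "2 < p"
  using assms prime_gt_1_nat[OF assms(1)] by (cases "p = 2") (auto simp: cong_def)

lemma Legendre_minus_one:
  assumes p: "prime p" "[p = 1] (mod 4)"
  shows "Legendre (-1) (int p) = 1"
proof -
  have p2: "2 < p" using p by (rule prime_cong_1_mod_4_gt_2)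
  have "even ((p - 1) div 2)" using p(2) by (simp add: cong_def) presburger
  then show ?thesis by (subst Legendre_eq_iff_pow_cong[OF p(1) p2]) auto
qed

text \<open>
  Let \<open>i\<^sup>2 = -1\<close> modulo \<open>p\<close>. Since \<open>(1 + i)\<^sup>2 = 2 i\<close>, the product \<open>2 i\<close> is a square, and hence so is
  \<open>i\<close> as soon as \<open>2\<close> is. Euler's criterion for \<open>i\<close> then reads \<open>(-1)\<^bsup>(p-1)/4\<^esup> = 1\<close>.
\<close>

lemma cong_1_mod_8_if_two_is_square:
  assumes p: "prime p" "[p = 1] (mod 4)" and two: "Legendre 2 (int p) = 1"
  shows "[p = 1] (mod 8)"
proof -
  have p2: "2 < p" using p by (rule prime_cong_1_mod_4_gt_2)
  obtain m where m: "p = 4 * m + 1"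
    using p(2) prime_gt_1_nat[OF p(1)] by (metis cong_def mod_mult_div_eq mod_less one_less_numeral_iff semiring_norm(76) add.commute)
  obtain i where i: "[i\<^sup>2 = -1] (mod int p)"
    using Legendre_minus_one[OF p] by (auto simp: Legendre_def QuadRes_def split: if_splits)
  have i0: "\<not> [i = 0] (mod int p)"
  proof
    assume "[i = 0] (mod int p)"
    then have "int p dvd i\<^sup>2" by (simp add: cong_0_iff power2_eq_square)
    then have "int p dvd -1" using i cong_dvd_iff by blast
    then show False using p2 by auto
  qed
  have two0: "\<not> [2 = 0] (mod int p)" using p2 by (auto simp: cong_0_iff dest: zdvd_imp_le)
  have "[i\<^sup>2 + (2 * i + 1) = -1 + (2 * i + 1)] (mod int p)" using i by (intro cong_add) auto
  then have "[(1 + i)\<^sup>2 = 2 * i] (mod int p)" by (simp add: power2_eq_square algebra_simps)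
  moreover have "\<not> [2 * i = 0] (mod int p)"
    using i0 two0 p by (simp add: cong_0_iff prime_dvd_mult_iff)
  ultimately have "Legendre (2 * i) (int p) = 1" by (auto simp: Legendre_def QuadRes_def)
  then have "Legendre i (int p) = 1" using two Legendre_mult[OF p(1) p2] by simp
  then have "[i ^ (2 * m) = 1] (mod int p)"
    using Legendre_eq_iff_pow_cong[OF p(1) p2, of 1 i] by (simp add: m)
  moreover have "[i ^ (2 * m) = (-1) ^ m] (mod int p)"
    unfolding power_mult using i by (rule cong_pow)
  ultimately have "[(-1) ^ m = (1::int)] (mod int p)" by (metis cong_sym cong_trans)
  then have "(-1) ^ m = (1::int)"
    using p2 by (intro sign_cong_imp_eq) (auto simp: minus_one_power_iff)
  then have "even m" by (simp add: minus_one_power_iff split: if_splits)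
  then show ?thesis by (auto simp: m cong_def elim!: evenE)
qed

section \<open>Sums of Legendre symbols\<close>

lemma bij_betw_residue_shift:
  assumes "m > 0"
  shows "bij_betw (\<lambda>x. (x + a) mod m) {0..m - 1} {0..m - 1 :: int}"
  by (rule bij_betwI[of _ _ _ "\<lambda>x. (x - a) mod m"]) (use assms in \<open>auto simp: mod_simps\<close>)

lemma bij_betw_residue_mult:
  assumes "m > 0" "coprime a m"
  shows "bij_betw (\<lambda>x. (a * x) mod m) {0..m - 1} {0..m - 1 :: int}"
proof -
  obtain b where b: "[a * b = 1] (mod m)" using assms(2) cong_solve_coprime_int by blast
  have inv: "(b * (a * x)) mod m = x mod m" "(a * (b * x)) mod m = x mod m" for x
    using cong_scalar_right[OF b, of x] by (simp_all add: cong_def mult_ac)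
  show ?thesis
    by (rule bij_betwI[of _ _ _ "\<lambda>x. (b * x) mod m"])
      (use assms(1) inv in \<open>auto simp: mod_simps\<close>)
qed

lemma sum_residues_shift:
  fixes f :: "int \<Rightarrow> 'a :: comm_monoid_add"
  assumes "m > 0" and f: "\<And>x. f (x mod m) = f x"
  shows "(\<Sum>x=0..m - 1. f (x + a)) = (\<Sum>x=0..m - 1. f x)"
  using sum.reindex_bij_betw[OF bij_betw_residue_shift[OF assms(1), of a], of f]
  by (simp add: f)

lemma sum_residues_mult:
  fixes f :: "int \<Rightarrow> 'a :: comm_monoid_add"
  assumes "m > 0" "coprime a m" and f: "\<And>x. f (x mod m) = f x"
  shows "(\<Sum>x=0..m - 1. f (a * x)) = (\<Sum>x=0..m - 1. f x)"
  using sum.reindex_bij_betw[OF bij_betw_residue_mult[OF assms(1,2)], of f]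
  by (simp add: f)

lemma Legendre_mod: "Legendre (x mod p) p = Legendre x p"
  by (rule Legendre_cong) (simp add: cong_def)

lemma Legendre_mod_add: "Legendre (x mod p + a) p = Legendre (x + a) p"
  by (rule Legendre_cong) (simp add: cong_def mod_simps)

lemma coprime_prime_iff_not_cong_0:
  "prime p \<Longrightarrow> coprime a (int p) \<longleftrightarrow> \<not> [a = 0] (mod int p)"
  by (metis cong_0_iff coprime_commute coprime_absorb_right not_prime_unit prime_imp_coprime prime_nat_int_transfer)

text \<open>
  If every residue were a square, squaring would be a surjection of a finite set onto itself, hence
  injective; but \<open>1\<close> and \<open>-1\<close> have the same square.
\<close>

lemma quadratic_nonresidue_exists:
  assumes p: "prime p" "2 < p"
  obtains a where "Legendre a (int p) = -1"
proof (rule ccontr)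
  assume "\<not> thesis"
  then have no: "Legendre a (int p) \<noteq> -1" for a using that by blast
  have sq: "QuadRes (int p) a" if "\<not> [a = 0] (mod int p)" for a
    using no[of a] that by (simp add: Legendre_def split: if_splits)
  let ?f = "\<lambda>y. y\<^sup>2 mod int p"
  have "{0..int p - 1} \<subseteq> ?f ` {0..int p - 1}"
  proof
    fix a assume a: "a \<in> {0..int p - 1}"
    have "QuadRes (int p) a"
    proof (cases "[a = 0] (mod int p)")
      case True
      then have "[0\<^sup>2 = a] (mod int p)" by (simp add: cong_sym_eq)
      then show ?thesis unfolding QuadRes_def by blast
    qed (rule sq)
    then obtain y where "[y\<^sup>2 = a] (mod int p)" by (auto simp: QuadRes_def)
    then have "a = ?f (y mod int p)" using a by (simp add: cong_def mod_simps)
    moreover have "y mod int p \<in> {0..int p - 1}" using p by simp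
    ultimately show "a \<in> ?f ` {0..int p - 1}" by blast
  qed
  then have "inj_on ?f {0..int p - 1}"
    by (rule finite_surj_inj[rotated]) simp
  moreover have "?f 1 = ?f (int p - 1)"
  proof -
    have "(int p - 1)\<^sup>2 = 1 + int p * (int p - 2)" by (simp add: power2_eq_square algebra_simps)
    then show ?thesis by simp
  qed
  ultimately have "1 = int p - 1" using p by (elim inj_onD) auto
  then show False using p by simp
qed

text \<open>
  Multiplication by a non-residue permutes the residues and changes the sign of the sum.
\<close>

lemma sum_Legendre_eq_0:
  assumes p: "prime p" "2 < p"
  shows "(\<Sum>x=0..int p - 1. Legendre x (int p)) = 0"
proof -
  obtain a where a: "Legendre a (int p) = -1" using quadratic_nonresidue_exists[OF p] .
  then have "coprime a (int p)"
    by (auto simp: coprime_prime_iff_not_cong_0[OF p(1)] Legendre_def)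
  then have "(\<Sum>x=0..int p - 1. Legendre x (int p)) = (\<Sum>x=0..int p - 1. Legendre (a * x) (int p))"
    using p by (intro sum_residues_mult[symmetric]) (auto simp: Legendre_mod)
  also have "\<dots> = - (\<Sum>x=0..int p - 1. Legendre x (int p))"
    by (simp add: Legendre_mult[OF p] a sum_negf)
  finally show ?thesis by simp
qed

lemma sum_Legendre_square:
  assumes "p > 0"
  shows "(\<Sum>x=0..int p - 1. Legendre x (int p) * Legendre x (int p)) = int p - 1"
proof -
  have "{0..int p - 1} = insert 0 {1..int p - 1}" using assms by auto
  moreover have "(\<Sum>x=1..int p - 1. Legendre x (int p) * Legendre x (int p)) = (\<Sum>x=1..int p - 1. 1)"
    by (intro sum.cong Legendre_square) (auto simp: cong_def)
  ultimately show ?thesis using assms by (simp add: Legendre_def)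
qed

text \<open>
  The substitution \<open>x \<mapsto> b x\<close> shows that the sum \<open>N b\<close> for the shift \<open>b\<close> does not depend on
  \<open>b \<noteq> 0\<close>. Summed over all shifts the correlations give the square of the sum of all Legendre symbols,
  that is \<open>0\<close>, while \<open>N 0 = p - 1\<close>. So \<open>(p - 1) + (p - 1) N 1 = 0\<close>.
\<close>

lemma sum_Legendre_correlation:
  assumes p: "prime p" "2 < p" and a: "\<not> [a = 0] (mod int p)"
  shows "(\<Sum>x=0..int p - 1. Legendre x (int p) * Legendre (x + a) (int p)) = -1"
proof -
  let ?L = "\<lambda>x. Legendre x (int p)"
  define N where "N b = (\<Sum>x=0..int p - 1. ?L x * ?L (x + b))" for b
  have N_eq: "N b = N 1" if b: "\<not> [b = 0] (mod int p)" for b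
  proof -
    have "N b = (\<Sum>x=0..int p - 1. ?L (b * x) * ?L (b * x + b))"
      unfolding N_def using p b
      by (intro sum_residues_mult[symmetric])
        (auto simp: Legendre_mod Legendre_mod_add coprime_prime_iff_not_cong_0)
    also have "\<dots> = (\<Sum>x=0..int p - 1. (?L b * ?L b) * (?L x * ?L (x + 1)))"
    proof (rule sum.cong[OF refl])
      fix x
      have "b * x + b = b * (x + 1)" by (simp add: algebra_simps)
      then show "?L (b * x) * ?L (b * x + b) = (?L b * ?L b) * (?L x * ?L (x + 1))"
        by (simp only: Legendre_mult[OF p] mult_ac)
    qed
    also have "\<dots> = N 1" unfolding Legendre_square[OF b] N_def by simp
    finally show ?thesis .
  qed
  have "(\<Sum>b=0..int p - 1. N b) = 0"
  proof -
    have "(\<Sum>b=0..int p - 1. N b) = (\<Sum>x=0..int p - 1. ?L x * (\<Sum>b=0..int p - 1. ?L (b + x)))"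
      unfolding N_def sum_distrib_left by (subst sum.swap) (simp add: add.commute)
    also have "\<dots> = (\<Sum>x=0..int p - 1. ?L x * (\<Sum>b=0..int p - 1. ?L b))"
      using p by (subst sum_residues_shift) (auto simp: Legendre_mod)
    finally show ?thesis by (simp add: sum_Legendre_eq_0[OF p])
  qed
  moreover have "{0..int p - 1} = insert 0 {1..int p - 1}" using p by auto
  moreover have "(\<Sum>b=1..int p - 1. N b) = (\<Sum>b=1..int p - 1. N 1)"
    by (intro sum.cong N_eq) (auto simp: cong_def)
  moreover have "N 0 = int p - 1" using sum_Legendre_square p by (simp add: N_def)
  ultimately have "(int p - 1) * (1 + N 1) = 0" using p by (simp add: algebra_simps)
  then have "N 1 = -1" using p by simp
  then show ?thesis using N_eq[OF a] by (simp add: N_def)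
qed

text \<open>
  For \<open>p = 1\<close> modulo \<open>4\<close> the Legendre symbol is an even function, which turns the convolution into
  the correlation. This sum is an entry of the square of the Paley matrix.
\<close>

lemma sum_Legendre_convolution:
  assumes p: "prime p" "[p = 1] (mod 4)" "2 < p"
  shows "(\<Sum>x=0..int p - 1. Legendre (g - x) (int p) * Legendre (x - h) (int p))
    = (if [g = h] (mod int p) then int p - 1 else -1)"
proof -
  let ?L = "\<lambda>x. Legendre x (int p)"
  have even: "?L (g - x) = ?L (x - g)" for x
    using Legendre_mult[OF p(1,3), of "-1" "x - g"] Legendre_minus_one[OF p(1,2)] by simp
  have "(\<Sum>x=0..int p - 1. ?L (g - x) * ?L (x - h)) = (\<Sum>x=0..int p - 1. ?L (x + - g) * ?L (x + - h))"
    by (simp add: even)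
  also have "\<dots> = (\<Sum>x=0..int p - 1. ?L (x + g + - g) * ?L (x + g + - h))"
    using p by (intro sum_residues_shift[symmetric])
      (auto simp: Legendre_mod_add[of _ _ "- g", simplified] Legendre_mod_add[of _ _ "- h", simplified])
  also have "\<dots> = (\<Sum>x=0..int p - 1. ?L x * ?L (x + (g - h)))"
    by (simp add: algebra_simps)
  also have "\<dots> = (if [g = h] (mod int p) then int p - 1 else -1)"
  proof (cases "[g = h] (mod int p)")
    case True
    then have "?L (x + (g - h)) = ?L x" for x
      by (intro Legendre_cong) (auto simp: cong_iff_dvd_diff)
    then show ?thesis using True sum_Legendre_square p by simp
  next
    case False
    then have "\<not> [g - h = 0] (mod int p)" by (simp add: cong_iff_dvd_diff)
    then show ?thesis using False sum_Legendre_correlation[OF p(1,3)] by simp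
  qed
  finally show ?thesis .
qed

section \<open>Subgroups of index two of the multiplicative group\<close>

text \<open>
  Otherwise \<open>a\<close> lies outside \<open>H\<close> as well, and \<open>H\<close>, \<open>H a\<close>, \<open>H a\<^sup>2\<close> are three different cosets.
\<close>

lemma (in group) square_mem_subgroup_of_index_2:
  assumes H: "subgroup H G" and index: "card (rcosets H) = 2" and a: "a \<in> carrier G"
  shows "a \<otimes> a \<in> H"
proof (rule ccontr)
  assume na: "a \<otimes> a \<notin> H"
  have HG: "H \<subseteq> carrier G" using H by (rule subgroup.subset)
  have mem: "x \<in> H #> x" if "x \<in> carrier G" for x
    using rcos_self[OF that H] .
  have ne: "a \<notin> H" using na subgroup.m_closed[OF H] by blast
  have "H #> \<one> = H" using HG by simp
  then have cosets: "{H, H #> a, H #> (a \<otimes> a)} \<subseteq> rcosets H"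
    using a HG by (metis (no_types) empty_subsetI insert_subset m_closed one_closed rcosetsI)
  have "H #> a \<noteq> H" using mem[OF a] ne by blast
  moreover have "H #> (a \<otimes> a) \<noteq> H" using mem[of "a \<otimes> a"] a na by blast
  moreover have "H #> (a \<otimes> a) \<noteq> H #> a"
  proof
    assume "H #> (a \<otimes> a) = H #> a"
    then have "a \<otimes> a \<in> H #> a" using mem[of "a \<otimes> a"] a by simp
    then obtain h where "h \<in> H" "a \<otimes> a = h \<otimes> a" by (auto simp: r_coset_def)
    then show False using a HG ne by (metis group.right_cancel is_group subsetD)
  qed
  ultimately have "card {H, H #> a, H #> (a \<otimes> a)} = 3" by (simp add: eq_commute)
  moreover have "finite (rcosets H)" using index by (metis card.infinite zero_neq_numeral)
  ultimately show False using card_mono[OF _ cosets] index by simp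
qed

lemma Z_mult_simps:
  "carrier (Z_mult p) = {1..int p - 1}" "x \<otimes>\<^bsub>Z_mult p\<^esub> y = (x * y) mod int p" "\<one>\<^bsub>Z_mult p\<^esub> = 1"
  by (auto simp: Z_mult_def residue_ring_def)

lemma Z_add_simps:
  "carrier (Z_add p) = {0..int p - 1}" "x \<otimes>\<^bsub>Z_add p\<^esub> y = (x + y) mod int p" "\<one>\<^bsub>Z_add p\<^esub> = 0"
  "Coset.order (Z_add p) = p"
  by (auto simp: Z_add_def residue_ring_def Coset.order_def)

lemma group_Z_mult: "prime p \<Longrightarrow> group (Z_mult p)"
  unfolding Z_mult_def
  by (rule field.field_mult_group) (rule residues_prime.is_field, simp add: residues_prime_def)

lemma group_Z_add:
  assumes "1 < p"
  shows "group (Z_add p)"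
proof -
  interpret residues "int p" "residue_ring (int p)" by (unfold_locales) (use assms in auto)
  show ?thesis unfolding Z_add_def by (rule a_group)
qed

text \<open>
  A subgroup of index two contains all squares. Conversely it has order \<open>(p - 1) / 2\<close>, so its elements
  satisfy \<open>x\<^bsup>(p-1)/2\<^esup> = 1\<close>, and these are squares by Euler's criterion.
\<close>

lemma index_2_subgroup_eq_quadratic_residues:
  assumes p: "prime p" "2 < p" and H: "subgroup H (Z_mult p)"
    and index: "card (rcosets\<^bsub>Z_mult p\<^esub> H) = 2"
  shows "H = {x \<in> {0..int p - 1}. Legendre x (int p) = 1}"
proof -
  interpret group "Z_mult p" using p(1) by (rule group_Z_mult)
  interpret res: residues_prime p "residue_ring (int p)" using p(1) by (simp add: residues_prime_def)
  have HG: "H \<subseteq> {1..int p - 1}" using subgroup.subset[OF H] by (simp add: Z_mult_simps)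
  have "card (rcosets\<^bsub>Z_mult p\<^esub> H) * card H = Coset.order (Z_mult p)"
    using lagrange[OF H] .
  then have cardH: "card H = (p - 1) div 2"
    using index by (simp add: Coset.order_def Z_mult_simps)
  show ?thesis
  proof (intro subset_antisym subsetI)
    fix x assume x: "x \<in> H"
    interpret HH: group "Z_mult p\<lparr>carrier := H\<rparr>" using H by (rule subgroup_imp_group)
    have "x [^]\<^bsub>Z_mult p\<lparr>carrier := H\<rparr>\<^esub> card H = 1"
      using HH.pow_order_eq_1[of x] x by (simp add: Coset.order_def Z_mult_simps)
    then have "x [^]\<^bsub>Z_mult p\<^esub> card H = 1" by (simp add: nat_pow_def)
    moreover have "x [^]\<^bsub>Z_mult p\<^esub> card H = x ^ card H mod int p"
      using res.pow_cong[of x "card H"] x HG by (auto simp: Z_mult_def nat_pow_mult_of)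
    ultimately have "[x ^ ((p - 1) div 2) = 1] (mod int p)"
      using p by (simp add: cong_def cardH)
    then show "x \<in> {x \<in> {0..int p - 1}. Legendre x (int p) = 1}"
      using Legendre_eq_iff_pow_cong[OF p, of 1 x] x HG by auto
  next
    fix x assume x: "x \<in> {x \<in> {0..int p - 1}. Legendre x (int p) = 1}"
    then have "\<not> [x = 0] (mod int p)" "QuadRes (int p) x"
      by (auto simp: Legendre_def split: if_splits)
    then obtain y where y: "[y\<^sup>2 = x] (mod int p)" by (auto simp: QuadRes_def)
    have "\<not> int p dvd y"
    proof
      assume "int p dvd y"
      then have "int p dvd y\<^sup>2" by (simp add: power2_eq_square)
      then show False using y \<open>\<not> [x = 0] (mod int p)\<close> cong_dvd_iff by (auto simp: cong_0_iff)
    qed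
    then have "y mod int p \<noteq> 0" "0 \<le> y mod int p" "y mod int p < int p"
      using p by (auto simp: dvd_eq_mod_eq_0)
    then have "y mod int p \<in> carrier (Z_mult p)" by (simp add: Z_mult_simps)
    from square_mem_subgroup_of_index_2[OF H index this]
    have "(y * y) mod int p \<in> H" by (simp add: Z_mult_simps mod_simps)
    then show "x \<in> H" using x y by (simp add: cong_def power2_eq_square)
  qed
qed

section \<open>The bordered Paley matrix\<close>

text \<open>
  For the set of quadratic residues the signed sum of translations is the Paley matrix: the only
  translation with a non-zero entry in position \<open>(i, j)\<close> is the one by \<open>u i - u j\<close>, and its sign
  is the Legendre symbol.
\<close>

lemma signed_regular_mat_quadratic_residues:
  assumes p: "0 < p" and u: "bij_betw u {..<p} {0..int p - 1}" and ij: "i < p" "j < p"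
  shows "signed_regular_mat (Z_add p) u {x \<in> {0..int p - 1}. Legendre x (int p) = 1} $$ (i, j)
    = of_int (Legendre (u i - u j) (int p))"
proof -
  let ?S = "{x \<in> {0..int p - 1}. Legendre x (int p) = 1}"
  let ?T = "{0..int p - 1} - {0} - ?S"
  define d where "d = (u i - u j) mod int p"
  have range: "u i \<in> {0..int p - 1}" "u j \<in> {0..int p - 1}"
    using bij_betwE[OF u] ij by auto
  have entry: "left_regular_mat (Z_add p) u g $$ (i, j) = (if g = d then 1 else 0)"
    if "g \<in> {0..int p - 1}" for g
  proof -
    have "u i = (g + u j) mod int p \<longleftrightarrow> [u i = g + u j] (mod int p)"
      using range by (simp add: cong_def)
    also have "\<dots> \<longleftrightarrow> [g = u i - u j] (mod int p)"
      unfolding cong_iff_dvd_diff by (subst dvd_diff_commute) (simp add: algebra_simps)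
    also have "\<dots> \<longleftrightarrow> g = d" using that by (simp add: cong_def d_def)
    finally show ?thesis using ij by (simp add: left_regular_mat_def Z_add_simps)
  qed
  have sums: "(\<Sum>g\<in>A. left_regular_mat (Z_add p) u g $$ (i, j)) = (if d \<in> A then 1 else 0)"
    if "A \<subseteq> {0..int p - 1}" for A
  proof -
    have "(\<Sum>g\<in>A. left_regular_mat (Z_add p) u g $$ (i, j)) = (\<Sum>g\<in>A. if g = d then 1 else 0)"
      using that by (intro sum.cong) (auto simp: entry)
    then show ?thesis using finite_subset[OF that] by simp
  qed
  have "?S \<subseteq> {0..int p - 1}" "?T \<subseteq> {0..int p - 1}" by auto
  then have "signed_regular_mat (Z_add p) u ?S $$ (i, j) =
      (if d \<in> ?S then 1 else 0) - (if d \<in> ?T then 1 else 0)"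
    using ij by (simp only: signed_regular_mat_def mat_sum_def Z_add_simps index_minus_mat
        index_mat dim_col_mat dim_row_mat case_prod_conv sums)
  moreover have "d \<in> {0..int p - 1}" using p by (simp add: d_def)
  moreover have "d = 0 \<longleftrightarrow> Legendre d (int p) = 0"
    using \<open>d \<in> _\<close> by (simp add: Legendre_eq_0_iff cong_def)
  moreover have "Legendre d (int p) = Legendre (u i - u j) (int p)" by (simp add: d_def Legendre_mod)
  ultimately show ?thesis using Legendre_values[of d "int p"] by auto
qed

lemma bordered_mat_index:
  assumes "Q \<in> carrier_mat m m" "i < m" "j < m"
  shows "bordered_mat m Q $$ (0, 0) = 0" "bordered_mat m Q $$ (0, Suc j) = 1"
    "bordered_mat m Q $$ (Suc i, 0) = 1" "bordered_mat m Q $$ (Suc i, Suc j) = Q $$ (i, j)"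
  using assms by (simp_all add: bordered_mat_def Let_def)

lemma bordered_mat_carrier:
  "Q \<in> carrier_mat m m \<Longrightarrow> bordered_mat m Q \<in> carrier_mat (m + 1) (m + 1)"
  by (auto simp: bordered_mat_def Let_def)

text \<open>
  Bordering the Paley matrix by ones makes its square a multiple of the identity: the border adds
  \<open>1\<close> to the entries \<open>-1\<close> and \<open>p - 1\<close> of the square of the Paley matrix, and the new products
  vanish because each row of the Paley matrix has sum \<open>0\<close>.
\<close>

lemma is_signature_paley_conference_matrix_iff:
  assumes p: "prime p" "[p = 1] (mod 4)" and u: "bij_betw u {..<p} {0..int p - 1}"
  defines "S \<equiv> {x \<in> {0..int p - 1}. Legendre x (int p) = 1}"
  shows "is_signature_matrix (p + 1) k (bordered_mat p (signed_regular_mat (Z_add p) u S))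
    \<longleftrightarrow> 2 * k = p + 1"
proof -
  let ?L = "\<lambda>x. Legendre x (int p)"
  have p2: "2 < p" using p by (rule prime_cong_1_mod_4_gt_2)
  define R where "R = signed_regular_mat (Z_add p) u S"
  define Q where "Q = bordered_mat p R"
  have R: "R $$ (i, j) = of_int (?L (u i - u j))" if "i < p" "j < p" for i j
    using signed_regular_mat_quadratic_residues[OF _ u that] p2 by (simp add: R_def S_def)
  have Rc: "R \<in> carrier_mat p p"
    by (simp add: R_def signed_regular_mat_def mat_sum_def Z_add_simps minus_carrier_mat)
  have Q: "Q $$ (0, 0) = 0" "i < p \<Longrightarrow> Q $$ (0, Suc i) = 1" "i < p \<Longrightarrow> Q $$ (Suc i, 0) = 1"
    "i < p \<Longrightarrow> j < p \<Longrightarrow> Q $$ (Suc i, Suc j) = of_int (?L (u i - u j))" for i j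
    using bordered_mat_index[OF Rc] R p2 by (auto simp: Q_def)
  have Qc: "Q \<in> carrier_mat (p + 1) (p + 1)" using bordered_mat_carrier[OF Rc] by (simp add: Q_def)
  have even: "?L (x - y) = ?L (y - x)" for x y
    using Legendre_mult[OF p(1) p2, of "-1" "x - y"] Legendre_minus_one[OF p] by simp
  have u_cong: "[u i = u j] (mod int p) \<longleftrightarrow> i = j" if "i < p" "j < p" for i j
  proof -
    have "u i \<in> {0..int p - 1}" "u j \<in> {0..int p - 1}" using bij_betwE[OF u] that by auto
    then have "[u i = u j] (mod int p) \<longleftrightarrow> u i = u j" by (simp add: cong_def)
    then show ?thesis using u that by (auto simp: bij_betw_def dest: inj_onD)
  qed
  have sum_u: "(\<Sum>l<p. F (u l)) = (\<Sum>x=0..int p - 1. F x)" for F :: "int \<Rightarrow> complex"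
    using sum.reindex_bij_betw[OF u] .
  have sum0: "(\<Sum>l<p. complex_of_int (?L (u l - g))) = 0" for g
  proof -
    have "(\<Sum>l<p. complex_of_int (?L (u l - g))) = of_int (\<Sum>x=0..int p - 1. ?L (x + - g))"
      using sum_u[of "\<lambda>x. of_int (?L (x - g))"] by simp
    then show ?thesis
      using sum_residues_shift[of "int p" ?L "- g"] p2 sum_Legendre_eq_0[OF p(1) p2]
      by (simp only: Legendre_mod) simp
  qed
  have sum0': "(\<Sum>l<p. complex_of_int (?L (g - u l))) = 0" for g
    by (subst even) (rule sum0)
  have sum2: "(\<Sum>l<p. complex_of_int (?L (u i - u l)) * of_int (?L (u l - u j)))
      = (if i = j then of_nat p - 1 else -1)" if "i < p" "j < p" for i j
  proof -
    have "(\<Sum>l<p. complex_of_int (?L (u i - u l)) * of_int (?L (u l - u j)))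
        = of_int (\<Sum>x=0..int p - 1. ?L (u i - x) * ?L (x - u j))"
      using sum_u[of "\<lambda>x. of_int (?L (u i - x)) * of_int (?L (x - u j))"] by simp
    then show ?thesis
      using u_cong[OF that] unfolding sum_Legendre_convolution[OF p p2] by simp
  qed
  show ?thesis
    unfolding R_def[symmetric] Q_def[symmetric]
  proof (rule is_signature_conference_matrix_iff)
    show "p + 1 \<ge> 2" using p2 by simp
    show "Q \<in> carrier_mat (p + 1) (p + 1)" by (rule Qc)
    have sym: "Q $$ (j, i) = cnj (Q $$ (i, j))" if "i < p + 1" "j < p + 1" for i j
      using that by (cases i; cases j) (auto simp: Q even)
    show "mat_adjoint Q = Q"
    proof (rule eq_matI)
      fix i j assume "i < dim_row Q" "j < dim_col Q"
      then show "mat_adjoint Q $$ (i, j) = Q $$ (i, j)"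
        using Qc sym[of j i] by (simp add: mat_adjoint_index)
    qed (use Qc in \<open>simp_all add: mat_adjoint_dim\<close>)
    show "Q $$ (i, i) = 0" if "i < p + 1" for i
      using that by (cases i) (auto simp: Q Legendre_def)
    show "cmod (Q $$ (i, j)) = 1" if "i < p + 1" "j < p + 1" "i \<noteq> j" for i j
    proof (cases i; cases j)
      fix i' j' assume [simp]: "i = Suc i'" "j = Suc j'"
      have "\<not> [u i' - u j' = 0] (mod int p)"
        using u_cong[of i' j'] that by (simp add: cong_iff_dvd_diff)
      then show ?thesis using that by (auto simp: Q Legendre_def)
    qed (use that in \<open>auto simp: Q\<close>)
    show "(\<Sum>l<p + 1. Q $$ (i, l) * Q $$ (l, j)) = (if i = j then of_nat (p + 1 - 1) else 0)"
      if "i < p + 1" "j < p + 1" for i j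
    proof -
      have "(\<Sum>l<p + 1. Q $$ (i, l) * Q $$ (l, j))
          = Q $$ (i, 0) * Q $$ (0, j) + (\<Sum>l<p. Q $$ (i, Suc l) * Q $$ (Suc l, j))"
        by (simp only: Suc_eq_plus1[symmetric] sum.lessThan_Suc_shift)
      also have "\<dots> = (if i = j then of_nat p else 0)"
        using that by (cases i; cases j) (auto simp: Q sum0 sum0' sum2)
      finally show ?thesis by simp
    qed
  qed
qed

theorem theorem5p16:
  fixes p :: nat and H :: "int set"
  defines "H \<equiv> generate (Z_mult p) {2}"
  assumes "prime p"
    and "[p = 1] (mod 4)"
    and "card (rcosets\<^bsub>Z_mult p\<^esub> H) = 2"
  shows "((\<exists>k. quasi_signature_set (Z_add p) H (p + 1) k) \<longleftrightarrow> [p = 1] (mod 8)) \<and>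
         (\<forall>k. quasi_signature_set (Z_add p) H (p + 1) k \<longrightarrow> real k = (real p + 1) / 2)"
proof -
  note p = assms(2,3) and index = assms(4)
  have p2: "2 < p" using p by (rule prime_cong_1_mod_4_gt_2)
  have "2 \<in> carrier (Z_mult p)" using p2 by (simp add: Z_mult_simps)
  then have "subgroup H (Z_mult p)"
    unfolding H_def using group_Z_mult[OF p(1)] by (intro group.generate_is_subgroup) auto
  then have H: "H = {x \<in> {0..int p - 1}. Legendre x (int p) = 1}"
    using index by (rule index_2_subgroup_eq_quadratic_residues[OF p(1) p2])
  have "2 \<in> H" unfolding H_def by (rule generate.incl) simp
  then have mod8: "[p = 1] (mod 8)"
    using cong_1_mod_8_if_two_is_square[OF p] by (simp add: H)
  have sig: "is_signature_matrix (p + 1) k (bordered_mat p (signed_regular_mat (Z_add p) u H))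
      \<longleftrightarrow> 2 * k = p + 1" if "bij_betw u {..<p} {0..int p - 1}" for u k
    unfolding H using is_signature_paley_conference_matrix_iff[OF p that] .
  have bij: "bij_betw int {..<p} {0..int p - 1}"
    by (rule bij_betwI[of _ _ _ nat]) auto
  have "H \<subseteq> {0..int p - 1} - {0}" by (auto simp: H Legendre_def)
  then have qs: "quasi_signature_set (Z_add p) H (p + 1) k \<longleftrightarrow> 2 * k = p + 1" for k
    unfolding quasi_signature_set_def Z_add_simps using group_Z_add[of p] p2 bij sig
    by (metis (no_types, lifting) finite_atLeastAtMost_int less_trans one_less_numeral_iff semiring_norm(76))
  have "2 * ((p + 1) div 2) = p + 1" using p(2) by (simp add: cong_def) presburger
  then have "\<exists>k. quasi_signature_set (Z_add p) H (p + 1) k" unfolding qs by blast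
  moreover have "real k = (real p + 1) / 2" if "quasi_signature_set (Z_add p) H (p + 1) k" for k
  proof -
    have "real (2 * k) = real (p + 1)" using that unfolding qs by (simp only:)
    then show ?thesis by simp
  qed
  ultimately show ?thesis using mod8 by blast
qed

end
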